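(* Let $T\in\mathbb{C}^{m\times n}$ be a partial isometry and let $A\in\mathbb{C}^{m\times n}$. If $A$ is $T$-normal, then $A$ is $T$-EP.
   Context: $\mathcal{R}(\cdot)$ denotes the range space and $^*$ the conjugate transpose. $T$ is a partial isometry if $T=TT^*T$. $A$ is $T$-normal if $A=TT^*A=AT^*T$ and $AA^*T=TA^*A$. $A$ is $T$-EP if $\mathcal{R}(A)=\mathcal{R}(TA^*T)$ and $A=AT^*T$. *)

theory Defs
  imports
    "Jordan_Normal_Form.Schur_Decomposition"
    "Jordan_Normal_Form.VS_Connect"
begin

definition range_space :: "complex mat \<Rightarrow> complex vec set" where
  "range_space A = (\<lambda>x. A *\<^sub>v x) ` carrier_vec (dim_col A)"

definition partial_isometry :: "complex mat \<Rightarrow> bool" where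
  "partial_isometry T \<longleftrightarrow> T = T * mat_adjoint T * T"

text \<open>
  In the two definitions below \<open>T\<close> and \<open>A\<close> are meant to have the same dimensions \<open>m\<close>, \<open>n\<close>.
  The adjoint then has dimensions \<open>n\<close>, \<open>m\<close> and all the products are well-formed.
\<close>

definition T_normal :: "complex mat \<Rightarrow> complex mat \<Rightarrow> bool" where
  "T_normal T A \<longleftrightarrow>
     A = T * mat_adjoint T * A \<and>
     A = A * mat_adjoint T * T \<and>
     A * mat_adjoint A * T = T * mat_adjoint A * A"

definition T_EP :: "complex mat \<Rightarrow> complex mat \<Rightarrow> bool" where
  "T_EP T A \<longleftrightarrow>
     range_space A = range_space (T * mat_adjoint A * T) \<and>
     A = A * mat_adjoint T * T"

text \<open>Sanity checks: the library adjoint is the conjugate transpose, and the range space is the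
  library column space.\<close>

lemma mat_adjoint_conjugate_transpose:
  fixes A :: "complex mat"
  assumes "A \<in> carrier_mat m n"
  shows "mat_adjoint A = mat n m (\<lambda>(i, j). cnj (A $$ (j, i)))"
  using assms by (intro eq_matI) (auto simp: mat_adjoint_def mat_of_rows_def)

lemma range_space_eq_col_space:
  assumes "A \<in> carrier_mat m n"
  shows "range_space A = vec_space.col_space m A"
  using assms by (subst vec_space.col_space_eq[OF assms]) (auto simp: range_space_def)

end

theory Submission
  imports Defs
begin

text \<open>
  The idea is to replace \<open>A\<close> by the square matrix \<open>B = A T\<^sup>*\<close>. Since \<open>A T\<^sup>* T = A\<close> and, taking adjoints in \<open>T T\<^sup>* A = A\<close>, also \<open>A\<^sup>* T T\<^sup>* = A\<^sup>*\<close>,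
  multiplying \<open>A A\<^sup>* T = T A\<^sup>* A\<close> by \<open>T\<^sup>*\<close> on the right gives
  \<open>B B\<^sup>* = A A\<^sup>* = T A\<^sup>* A T\<^sup>* = B\<^sup>* B\<close>; so \<open>B\<close> is normal in the ordinary sense.
  The same two identities show that \<open>B\<close> has the range of \<open>A\<close>, and that \<open>B\<^sup>* = T A\<^sup>*\<close> has the range
  of \<open>T A\<^sup>* T\<close>. What is left is the fact that a normal matrix and its adjoint have the same range
  (\<open>range_space_normal_adjoint\<close>).

  That fact follows from \<open>M = M M\<^sup>* X\<close> being solvable for every complex matrix \<open>M\<close>
  (\<open>factor_through_gram\<close>): for normal \<open>B\<close> this writes \<open>B = B B\<^sup>* X = B\<^sup>* (B X)\<close>, and likewise with
  \<open>B\<close> and \<open>B\<^sup>*\<close> exchanged. A solution \<open>X\<close> is built without any dimension count, from a matrix \<open>G\<close>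
  with \<open>C G C = C\<close> for \<open>C = M M\<^sup>*\<close> (\<open>inner_inverse_exists\<close>, by Gauss-Jordan elimination):
  \<open>C G M - M\<close> is killed by right multiplication by \<open>M\<^sup>*\<close>, hence it is zero by positivity of the
  standard inner product.
\<close>

section \<open>Inner inverses over a field\<close>

text \<open>
  In a reduced row echelon form the pivot columns are distinct unit vectors and the rows without a
  pivot vanish. Sending the \<open>i\<close>-th unit vector to the unit vector at the \<open>i\<close>-th pivot column is
  therefore a right inverse of \<open>E\<close> on the nonzero rows, and only those rows matter.
\<close>

lemma inner_inverse_row_echelon:
  fixes E :: "'a :: field mat"
  assumes E: "E \<in> carrier_mat nr nc" and ech: "row_echelon_form E"
  shows "\<exists>G \<in> carrier_mat nc nr. E * G * E = E"
proof -
  from ech E obtain f where p: "pivot_fun E f nc"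
    unfolding row_echelon_form_def by auto
  have dr: "dim_row E = nr" using E by simp
  note p = pivot_funD[OF dr p]
  define G :: "'a mat" where "G = mat nc nr (\<lambda>(j, i). if f i = j then 1 else 0)"
  have G: "G \<in> carrier_mat nc nr" by (simp add: G_def)
  have EG: "(E * G) $$ (k, i) = (if f i < nc \<and> k = i then 1 else 0)"
    if k: "k < nr" and i: "i < nr" for k i
  proof -
    have "(E * G) $$ (k, i) = (\<Sum>j = 0..<nc. E $$ (k, j) * (if f i = j then 1 else 0))"
      using E G k i by (simp add: scalar_prod_def G_def)
    also have "\<dots> = (\<Sum>j = 0..<nc. if f i = j then E $$ (k, j) else 0)"
      by (rule sum.cong) auto
    also have "\<dots> = (if f i < nc then E $$ (k, f i) else 0)"
      by (simp add: sum.delta')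
    also have "\<dots> = (if f i < nc \<and> k = i then 1 else 0)"
      using p(4)[OF i] p(5)[OF i _ k] by auto
    finally show ?thesis .
  qed
  have "E * G * E = E"
  proof (rule eq_matI)
    fix k l assume "k < dim_row E" "l < dim_col E"
    then have k: "k < nr" and l: "l < nc" using E by auto
    have "(E * G * E) $$ (k, l) = (\<Sum>i = 0..<nr. (E * G) $$ (k, i) * E $$ (i, l))"
      using E G k l by (simp add: scalar_prod_def del: assoc_mult_mat)
    also have "\<dots> = (\<Sum>i = 0..<nr. if k = i then (if f k < nc then E $$ (k, l) else 0) else 0)"
      by (rule sum.cong) (auto simp: EG k)
    also have "\<dots> = (if f k < nc then E $$ (k, l) else 0)"
      using k by simp
    also have "\<dots> = E $$ (k, l)"
      using p(1)[OF k] p(2)[OF k, of l] l by auto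
    finally show "(E * G * E) $$ (k, l) = E $$ (k, l)" .
  qed (use E G in auto)
  with G show ?thesis by blast
qed

lemma inner_inverse_exists:
  fixes C :: "'a :: field mat"
  assumes C: "C \<in> carrier_mat nr nc"
  shows "\<exists>G \<in> carrier_mat nc nr. C * G * C = C"
proof -
  define E where "E = gauss_jordan_single C"
  note gj = gauss_jordan_single[OF C E_def[symmetric]]
  note E = gj(2)
  from gj(4) obtain P Q where EPC: "E = P * C"
    and P: "P \<in> carrier_mat nr nr" and Q: "Q \<in> carrier_mat nr nr" and QP: "Q * P = 1\<^sub>m nr"
    by blast
  from inner_inverse_row_echelon[OF E gj(3)] obtain H
    where H: "H \<in> carrier_mat nc nr" and EHE: "E * H * E = E" by blast
  have CQE: "C = Q * E"
    unfolding EPC using C P Q QP by (simp flip: assoc_mult_mat)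
  have "C * (H * P) * C = C * H * E"
    unfolding EPC using C P H by (simp add: assoc_mult_mat[of _ _ nr _ nr _ nc] 
      assoc_mult_mat[of _ _ nc _ nr _ nc] assoc_mult_mat[of _ _ nc _ nr _ nr])
  also have "\<dots> = Q * (E * H * E)"
    unfolding CQE using Q E H by (simp add: assoc_mult_mat[of _ nr nr _ nc _ nr]
      assoc_mult_mat[of _ nr nr _ nr _ nc])
  also have "\<dots> = C" by (simp add: EHE CQE)
  finally show ?thesis using H P by (intro bexI[of _ "H * P"]) auto
qed

section \<open>The adjoint of a complex matrix\<close>

lemma mat_adjoint_carrier [simp]:
  "M \<in> carrier_mat m n \<Longrightarrow> mat_adjoint M \<in> carrier_mat n m" for M :: "complex mat"
  by (simp add: mat_adjoint_conjugate_transpose)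

lemma mat_adjoint_adjoint:
  fixes M :: "complex mat"
  shows "mat_adjoint (mat_adjoint M) = M"
proof -
  have M: "M \<in> carrier_mat (dim_row M) (dim_col M)" by simp
  show ?thesis
    unfolding mat_adjoint_conjugate_transpose[OF mat_adjoint_carrier[OF M]]
    unfolding mat_adjoint_conjugate_transpose[OF M]
    by (rule eq_matI) auto
qed

lemma mat_adjoint_mult:
  fixes M N :: "complex mat"
  assumes M: "M \<in> carrier_mat m n" and N: "N \<in> carrier_mat n k"
  shows "mat_adjoint (M * N) = mat_adjoint N * mat_adjoint M"
proof -
  have MN: "M * N \<in> carrier_mat m k" using M N by simp
  show ?thesis
    unfolding mat_adjoint_conjugate_transpose[OF MN] mat_adjoint_conjugate_transpose[OF M]
      mat_adjoint_conjugate_transpose[OF N]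
    using M N by (intro eq_matI) (auto simp: scalar_prod_def mult.commute)
qed

text \<open>The diagonal entries of \<open>M M\<^sup>*\<close> are the squared norms of the rows of \<open>M\<close>.\<close>

lemma mult_adjoint_eq_0:
  fixes M :: "complex mat"
  assumes M: "M \<in> carrier_mat m n" and zero: "M * mat_adjoint M = 0\<^sub>m m m"
  shows "M = 0\<^sub>m m n"
proof (rule eq_matI)
  fix i j assume "i < dim_row (0\<^sub>m m n :: complex mat)" "j < dim_col (0\<^sub>m m n :: complex mat)"
  then have i: "i < m" and j: "j < n" by auto
  have "(M * mat_adjoint M) $$ (i, i) = (\<Sum>k = 0..<n. M $$ (i, k) * cnj (M $$ (i, k)))"
    unfolding mat_adjoint_conjugate_transpose[OF M] using M i by (simp add: scalar_prod_def)
  also have "\<dots> = complex_of_real (\<Sum>k = 0..<n. (cmod (M $$ (i, k)))\<^sup>2)"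
    by (simp add: complex_norm_square del: of_real_power)
  finally have "complex_of_real (\<Sum>k = 0..<n. (cmod (M $$ (i, k)))\<^sup>2) = 0"
    using zero i by simp
  then have "(\<Sum>k = 0..<n. (cmod (M $$ (i, k)))\<^sup>2) = 0"
    by (simp only: of_real_eq_0_iff)
  then have "(cmod (M $$ (i, j)))\<^sup>2 = 0"
    using j by (subst (asm) sum_nonneg_eq_0_iff) auto
  then show "M $$ (i, j) = 0\<^sub>m m n $$ (i, j)" using i j by simp
qed (use M in auto)

section \<open>Ranges of normal matrices\<close>

text \<open>
  With \<open>G\<close> an inner inverse of \<open>C = M M\<^sup>*\<close>, the matrix \<open>N = (C G - 1) M\<close> satisfies
  \<open>N M\<^sup>* = C G C - C = 0\<close>. Since \<open>N\<^sup>* = M\<^sup>* (C G - 1)\<^sup>*\<close>, also \<open>N N\<^sup>* = 0\<close>;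
  hence \<open>N = 0\<close> and \<open>X = G M\<close> is a solution.
\<close>

lemma factor_through_gram:
  fixes M :: "complex mat"
  assumes M: "M \<in> carrier_mat m n"
  shows "\<exists>X \<in> carrier_mat m n. M = M * mat_adjoint M * X"
proof -
  define C where "C = M * mat_adjoint M"
  have Ma: "mat_adjoint M \<in> carrier_mat n m" using M by simp
  have C: "C \<in> carrier_mat m m" using M Ma by (simp add: C_def)
  from inner_inverse_exists[OF C] obtain G
    where G: "G \<in> carrier_mat m m" and CGC: "C * G * C = C" by blast
  define K where "K = C * G - 1\<^sub>m m"
  have CG: "C * G \<in> carrier_mat m m" using C G by simp
  have K: "K \<in> carrier_mat m m" unfolding K_def by (rule minus_carrier_mat) simp
  have KC: "K * C = 0\<^sub>m m m"
    using CG C CGC by (simp add: K_def minus_mult_distrib_mat)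
  have Ka: "mat_adjoint K \<in> carrier_mat m m" using K by simp
  have "(K * M) * mat_adjoint (K * M) = K * M * (mat_adjoint M * mat_adjoint K)"
    by (simp add: mat_adjoint_mult[OF K M])
  also have "\<dots> = K * C * mat_adjoint K"
    unfolding assoc_mult_mat[OF K C Ka] unfolding C_def assoc_mult_mat[OF M Ma Ka]
    by (rule assoc_mult_mat[OF K M mult_carrier_mat[OF Ma Ka]])
  also have "\<dots> = 0\<^sub>m m m" using KC Ka by simp
  finally have "K * M = 0\<^sub>m m n"
    using mult_adjoint_eq_0[of "K * M" m n] K M by simp
  then have diff: "C * G * M - M = 0\<^sub>m m n"
    using CG M by (simp add: K_def minus_mult_distrib_mat)
  have "M = Y" if Y: "Y \<in> carrier_mat m n" and YM: "Y - M = 0\<^sub>m m n" for Y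
  proof (rule eq_matI)
    fix i j assume "i < dim_row Y" "j < dim_col Y"
    then have i: "i < m" and j: "j < n" using Y by auto
    have "(Y - M) $$ (i, j) = 0" using YM i j by simp
    then show "M $$ (i, j) = Y $$ (i, j)" using M Y i j by simp
  qed (use Y M in auto)
  from this[OF mult_carrier_mat[OF CG M] diff] have "M = C * G * M" .
  also have "\<dots> = C * (G * M)" by (rule assoc_mult_mat[OF C G M])
  finally show ?thesis
    unfolding C_def using G M by (intro bexI[of _ "G * M"]) auto
qed

lemma range_space_mult_subset:
  assumes M: "M \<in> carrier_mat m n" and N: "N \<in> carrier_mat n k"
  shows "range_space (M * N) \<subseteq> range_space M"
proof -
  have "(M * N) *\<^sub>v x \<in> range_space M" if "x \<in> carrier_vec k" for x
    using M N that by (simp add: range_space_def assoc_mult_mat_vec[OF M N])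
  then show ?thesis using N by (auto simp: range_space_def)
qed

lemma range_space_normal_subset:
  assumes B: "B \<in> carrier_mat m m" and normal: "B * mat_adjoint B = mat_adjoint B * B"
  shows "range_space B \<subseteq> range_space (mat_adjoint B)"
proof -
  from factor_through_gram[OF B] obtain X
    where X: "X \<in> carrier_mat m m" and "B = B * mat_adjoint B * X" by blast
  then have "B = mat_adjoint B * B * X" by (simp only: normal)
  also have "\<dots> = mat_adjoint B * (B * X)"
    by (rule assoc_mult_mat[OF mat_adjoint_carrier[OF B] B X])
  finally have "range_space B = range_space (mat_adjoint B * (B * X))" by simp
  also have "\<dots> \<subseteq> range_space (mat_adjoint B)"
    by (rule range_space_mult_subset[of _ m m _ m]) (use B X in auto)
  finally show ?thesis .
qed

lemma range_space_normal_adjoint: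
  assumes B: "B \<in> carrier_mat m m" and normal: "B * mat_adjoint B = mat_adjoint B * B"
  shows "range_space (mat_adjoint B) = range_space B"
proof
  show "range_space B \<subseteq> range_space (mat_adjoint B)"
    by (rule range_space_normal_subset[OF B normal])
  have "mat_adjoint B * mat_adjoint (mat_adjoint B) = mat_adjoint (mat_adjoint B) * mat_adjoint B"
    unfolding mat_adjoint_adjoint by (rule normal[symmetric])
  from range_space_normal_subset[OF mat_adjoint_carrier[OF B] this]
  show "range_space (mat_adjoint B) \<subseteq> range_space B"
    unfolding mat_adjoint_adjoint .
qed

lemma range_space_mult_eq:
  assumes M: "M \<in> carrier_mat m n" and N: "N \<in> carrier_mat n k" and R: "R \<in> carrier_mat k n"
    and undo: "M * N * R = M"
  shows "range_space (M * N) = range_space M"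
proof
  show "range_space (M * N) \<subseteq> range_space M"
    by (rule range_space_mult_subset[OF M N])
  show "range_space M \<subseteq> range_space (M * N)"
    using range_space_mult_subset[OF mult_carrier_mat[OF M N] R] by (simp only: undo)
qed

section \<open>\<open>T\<close>-normal matrices\<close>

text \<open>
  The identity \<open>A T\<^sup>* T = A\<close> collapses \<open>B B\<^sup>* = A T\<^sup>* T A\<^sup>*\<close> to \<open>A A\<^sup>*\<close>. The adjoint \<open>A\<^sup>* T T\<^sup>* = A\<^sup>*\<close>
  of the other absorption identity then inserts the factor \<open>T\<close> that lets \<open>A A\<^sup>* T = T A\<^sup>* A\<close> act,
  and it is also the reason for the last claim.
\<close>

lemma T_normal_imp_normal:
  assumes T: "T \<in> carrier_mat m n" and A: "A \<in> carrier_mat m n" and TA: "T_normal T A"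
  defines "B \<equiv> A * mat_adjoint T"
  shows "B * mat_adjoint B = mat_adjoint B * B"
    and "mat_adjoint B = T * mat_adjoint A"
    and "mat_adjoint B * T * mat_adjoint T = mat_adjoint B"
proof -
  let ?T' = "mat_adjoint T" and ?A' = "mat_adjoint A"
  have T': "?T' \<in> carrier_mat n m" and A': "?A' \<in> carrier_mat n m" using T A by auto
  note TT' = mult_carrier_mat[OF T T'] and TA' = mult_carrier_mat[OF T A']
    and AT' = mult_carrier_mat[OF A T'] and AA' = mult_carrier_mat[OF A A']
  note normality = TA[unfolded T_normal_def]
  note left = normality[THEN conjunct1, symmetric]
    and right = normality[THEN conjunct2, THEN conjunct1, symmetric]
    and comm = normality[THEN conjunct2, THEN conjunct2]
  show adj: "mat_adjoint B = T * ?A'"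
    unfolding B_def by (simp add: mat_adjoint_mult[OF A T'] mat_adjoint_adjoint)
  have "mat_adjoint (T * ?T' * A) = ?A' * (T * ?T')"
    using T T' A by (simp add: mat_adjoint_mult[of _ m m _ n] mat_adjoint_mult[of _ m n _ m]
        mat_adjoint_adjoint)
  then have left': "?A' * (T * ?T') = ?A'" by (simp add: left)
  have "T * ?A' * T * ?T' = T * (?A' * (T * ?T'))"
    by (simp only: assoc_mult_mat[OF TA' T T'] assoc_mult_mat[OF T A' TT'])
  then show "mat_adjoint B * T * ?T' = mat_adjoint B"
    by (simp only: adj left')
  have "B * mat_adjoint B = (A * ?T' * T) * ?A'"
    unfolding adj unfolding B_def by (rule assoc_mult_mat[OF AT' T A', symmetric])
  also have "\<dots> = A * (?A' * (T * ?T'))" by (simp only: right left')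
  also have "\<dots> = (A * ?A' * T) * ?T'"
    by (simp only: assoc_mult_mat[OF A A' TT'] assoc_mult_mat[OF AA' T T'])
  also have "\<dots> = mat_adjoint B * B"
    unfolding comm adj unfolding B_def by (rule assoc_mult_mat[OF TA' A T'])
  finally show "B * mat_adjoint B = mat_adjoint B * B" .
qed

theorem theorem2p6:
  fixes T A :: "complex mat" and m n :: nat
  assumes "T \<in> carrier_mat m n"
    and "A \<in> carrier_mat m n"
    and "partial_isometry T"
    and "T_normal T A"
  shows "T_EP T A"
proof -
  note T = assms(1) and A = assms(2)
  let ?T' = "mat_adjoint T"
  have T': "?T' \<in> carrier_mat n m" using T by simp
  have right: "A = A * ?T' * T"
    using assms(4) unfolding T_normal_def by (elim conjE)
  define B where "B = A * ?T'"
  have B: "B \<in> carrier_mat m m" using A T' by (simp add: B_def)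
  note normal = T_normal_imp_normal[OF T A assms(4), folded B_def]
  have "range_space A = range_space B"
    unfolding B_def by (rule range_space_mult_eq[OF A T' T right[symmetric], symmetric])
  also have "\<dots> = range_space (mat_adjoint B)"
    by (rule range_space_normal_adjoint[OF B normal(1), symmetric])
  also have "\<dots> = range_space (mat_adjoint B * T)"
    by (rule range_space_mult_eq[OF mat_adjoint_carrier[OF B] T T' normal(3), symmetric])
  also have "\<dots> = range_space (T * mat_adjoint A * T)"
    by (simp only: normal(2))
  finally show ?thesis using right unfolding T_EP_def by (rule conjI)
qed

end
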